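(* Let $\mathbf{H}\in\mathbb{H}^4$. The following are equivalent: (1) $\mathbf{H}$ is triclinic; (2) $\mathbf{Cov}_2(\mathbf{H})$ is triclinic; (3) the triple $(\mathbf{d}_2,\mathbf{c}_3,\mathbf{c}_4)$ is triclinic.
   Context: $\mathbb{H}^4$ is the space of totally symmetric traceless fourth-order tensors on $\mathbb{R}^3$, with $SO(3)$-action $(g\star\mathbf{T})(x_1,\dots,x_n)=\mathbf{T}(g^{-1}x_1,\dots,g^{-1}x_n)$. $\mathbf{Cov}_2(\mathbf{H})\subset\mathrm{Sym}^2(\mathbb{R}^3)$ is the set of values at $\mathbf{H}$ of all $SO(3)$-equivariant polynomial maps $\mathbb{H}^4\to\mathrm{Sym}^2(\mathbb{R}^3)$. $(\mathbf{H}:\mathbf{H})_{ijkl}=H_{ijmn}H_{mnkl}$, $(\mathbf{H}:\mathbf{a})_{ij}=H_{ijkl}a_{kl}$, $(\operatorname{tr}_{13}\mathbf{A})_{ij}=A_{kikj}$, $\mathbf{d}_2=\operatorname{tr}_{13}(\mathbf{H}:\mathbf{H})$, $\mathbf{c}_3=\mathbf{H}:\mathbf{d}_2$, $\mathbf{c}_4=\mathbf{H}:\mathbf{c}_3$. Symmetry group of a tensor: $\{g\in SO(3):g\star\mathbf{T}=\mathbf{T}\}$; of a family or subspace: intersection; symmetry class: conjugacy class. Triclinic means trivial symmetry group. *)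

theory Defs
  imports "HOL-Analysis.Analysis"
begin

text \<open>Tensors on R^3 in components with respect to the standard basis,
indices ranging over the 3-element type 3.\<close>

type_synonym tensor4 = "3 \<Rightarrow> 3 \<Rightarrow> 3 \<Rightarrow> 3 \<Rightarrow> real"
type_synonym tensor2 = "3 \<Rightarrow> 3 \<Rightarrow> real"

definition SO3 :: "(real^3^3) set" where
  "SO3 = {g. orthogonal_matrix g \<and> det g = 1}"

text \<open>(g * T)(x1,..,xn) = T(g^-1 x1, .., g^-1 xn), in components.\<close>
definition act4 :: "real^3^3 \<Rightarrow> tensor4 \<Rightarrow> tensor4" where
  "act4 g T = (\<lambda>i j k l. \<Sum>a\<in>UNIV. \<Sum>b\<in>UNIV. \<Sum>c\<in>UNIV. \<Sum>d\<in>UNIV.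
      g$i$a * g$j$b * g$k$c * g$l$d * T a b c d)"

definition act2 :: "real^3^3 \<Rightarrow> tensor2 \<Rightarrow> tensor2" where
  "act2 g A = (\<lambda>i j. \<Sum>a\<in>UNIV. \<Sum>b\<in>UNIV. g$i$a * g$j$b * A a b)"

definition Sym2 :: "tensor2 set" where
  "Sym2 = {A. \<forall>i j. A i j = A j i}"

definition H4 :: "tensor4 set" where
  "H4 = {T. (\<forall>i j k l. T i j k l = T j i k l \<and> T i j k l = T i k j l \<and> T i j k l = T i j l k)
           \<and> (\<forall>k l. (\<Sum>i\<in>UNIV. T i i k l) = 0)}"

inductive_set poly4 :: "(tensor4 \<Rightarrow> real) set" where
  const: "(\<lambda>T. c) \<in> poly4"
| coord: "(\<lambda>T. T i j k l) \<in> poly4"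
| add: "p \<in> poly4 \<Longrightarrow> q \<in> poly4 \<Longrightarrow> (\<lambda>T. p T + q T) \<in> poly4"
| mult: "p \<in> poly4 \<Longrightarrow> q \<in> poly4 \<Longrightarrow> (\<lambda>T. p T * q T) \<in> poly4"

definition poly_map42 :: "(tensor4 \<Rightarrow> tensor2) \<Rightarrow> bool" where
  "poly_map42 f \<longleftrightarrow> (\<forall>i j. (\<lambda>T. f T i j) \<in> poly4)"

definition equiv_poly_cov2 :: "(tensor4 \<Rightarrow> tensor2) \<Rightarrow> bool" where
  "equiv_poly_cov2 f \<longleftrightarrow> poly_map42 f \<and> (\<forall>T\<in>H4. f T \<in> Sym2)
     \<and> (\<forall>g\<in>SO3. \<forall>T\<in>H4. f (act4 g T) = act2 g (f T))"

definition Cov2 :: "tensor4 \<Rightarrow> tensor2 set" where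
  "Cov2 H = {f H | f. equiv_poly_cov2 f}"

definition symgroup4 :: "tensor4 \<Rightarrow> (real^3^3) set" where
  "symgroup4 T = {g\<in>SO3. act4 g T = T}"

definition symgroup2_set :: "tensor2 set \<Rightarrow> (real^3^3) set" where
  "symgroup2_set S = {g\<in>SO3. \<forall>A\<in>S. act2 g A = A}"

definition triclinic :: "(real^3^3) set \<Rightarrow> bool" where
  "triclinic G \<longleftrightarrow> G = {mat 1}"

definition dcontr44 :: "tensor4 \<Rightarrow> tensor4 \<Rightarrow> tensor4" where
  "dcontr44 A B = (\<lambda>i j k l. \<Sum>m\<in>UNIV. \<Sum>n\<in>UNIV. A i j m n * B m n k l)"

definition dcontr42 :: "tensor4 \<Rightarrow> tensor2 \<Rightarrow> tensor2" where
  "dcontr42 A a = (\<lambda>i j. \<Sum>k\<in>UNIV. \<Sum>l\<in>UNIV. A i j k l * a k l)"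

definition tr13 :: "tensor4 \<Rightarrow> tensor2" where
  "tr13 A = (\<lambda>i j. \<Sum>k\<in>UNIV. A k i k j)"

definition d2 :: "tensor4 \<Rightarrow> tensor2" where
  "d2 H = tr13 (dcontr44 H H)"

definition c3 :: "tensor4 \<Rightarrow> tensor2" where
  "c3 H = dcontr42 H (d2 H)"

definition c4 :: "tensor4 \<Rightarrow> tensor2" where
  "c4 H = dcontr42 H (c3 H)"

end

theory Submission
  imports Defs
begin

text \<open>
  By equivariance the symmetry groups increase from \<open>H\<close> to its covariants and to the triple, so the point is
  that \<open>H\<close> has a nontrivial symmetry as soon as some rotation \<open>g \<noteq> 1\<close> fixes \<open>d2, c3, c4\<close>. Turn the axis of
  \<open>g\<close> to \<open>e\<^sub>3\<close>, which then is a common eigenvector of the triple. The part of \<open>H\<close> that is odd under the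
  half-turn about \<open>e\<^sub>3\<close> therefore annihilates \<open>d2\<close> and \<open>c3\<close>. As a linear map this part has rank 0, in which
  case the half-turn is a symmetry; or rank 1, in which case the equations on \<open>d2\<close> force a symmetry about a
  perpendicular axis; or rank 2, in which case \<open>c3 = l d2 + k 1\<close> or \<open>d2\<close> is scalar.

  If \<open>d2\<close> is scalar, a frame whose third vector maximises the quartic form of \<open>H\<close> on the sphere exhibits a
  half-turn symmetry. Otherwise diagonalise \<open>d2\<close>. Since \<open>d2\<close> is an eigenvector of \<open>H\<close> modulo scalars, the part of \<open>H\<close> which is not
  orthotropic depends on three numbers \<open>r1, r2, r3\<close> only; if all were nonzero, the vanishing of the
  off-diagonal entries of \<open>d2\<close> would make \<open>d2\<close> scalar, and if one vanishes then so does another, which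
  leaves a half-turn symmetry. When \<open>d2\<close> has a double eigenvalue, a suitable rotation about its axis
  exhibits the symmetry.
\<close>

section \<open>Equivariance\<close>

text \<open>The action on a single index. Iterating it gives \<open>act2\<close> and
  \<open>act4\<close>, so that equivariance is proved one index at a time instead of through
  multiple sums.\<close>

definition rot1 :: "real^3^3 \<Rightarrow> (3 \<Rightarrow> real) \<Rightarrow> 3 \<Rightarrow> real" where
  "rot1 g X i = (\<Sum>a\<in>UNIV. g$i$a * X a)"

lemma rot1_mult_left: "rot1 g X i * y = rot1 g (\<lambda>a. X a * y) i"
  and rot1_mult_right: "y * rot1 g X i = rot1 g (\<lambda>a. y * X a) i"
  by (simp_all add: rot1_def sum_distrib_left sum_distrib_right mult_ac)

lemma rot1_swap: "rot1 g (\<lambda>a. rot1 h (\<lambda>b. X a b) j) i = rot1 h (\<lambda>b. rot1 g (\<lambda>a. X a b) i) j"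
proof -
  have "rot1 g (\<lambda>a. rot1 h (\<lambda>b. X a b) j) i
      = (\<Sum>a\<in>UNIV. \<Sum>b\<in>UNIV. g$i$a * (h$j$b * X a b))"
    by (simp add: rot1_def sum_distrib_left)
  also have "\<dots> = (\<Sum>b\<in>UNIV. \<Sum>a\<in>UNIV. g$i$a * (h$j$b * X a b))"
    by (rule sum.swap)
  also have "\<dots> = rot1 h (\<lambda>b. rot1 g (\<lambda>a. X a b) i) j"
    by (simp add: rot1_def sum_distrib_left mult_ac)
  finally show ?thesis .
qed

lemma rot1_sum: "(\<Sum>k\<in>UNIV. rot1 g (\<lambda>a. X a k) i) = rot1 g (\<lambda>a. \<Sum>k\<in>UNIV. X a k) i"
  by (simp add: rot1_def sum_distrib_left) (rule sum.swap)

lemma rot1_matrix_mult: "rot1 g (\<lambda>i. rot1 h X i) k = rot1 (g ** h) X k"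
  unfolding rot1_def matrix_matrix_mult_def
  by (simp add: sum_distrib_left sum_distrib_right mult_ac) (rule sum.swap)

text \<open>Orthogonal maps preserve the inner product. Contractions over a repeated index are
  reduced to this fact.\<close>

lemma rot1_contract:
  assumes "orthogonal_matrix g"
  shows "(\<Sum>k\<in>UNIV. rot1 g X k * rot1 g Y k) = (\<Sum>a\<in>UNIV. X a * Y a)"
proof -
  have rot: "rot1 g Z k = (g *v (\<chi> a. Z a)) $ k" for Z k
    by (simp add: rot1_def matrix_vector_mult_def)
  have "(g *v (\<chi> a. X a)) \<bullet> (g *v (\<chi> a. Y a)) = (\<chi> a. X a) \<bullet> (\<chi> a. Y a)"
    using assms orthogonal_transformation_matrix[of "(*v) g"]
    by (simp add: orthogonal_transformation_def)
  then show ?thesis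
    by (simp add: inner_vec_def rot)
qed

lemma act2_rot1: "act2 g A i j = rot1 g (\<lambda>a. rot1 g (\<lambda>b. A a b) j) i"
  by (simp add: act2_def rot1_def sum_distrib_left mult_ac)

lemma act4_rot1:
  "act4 g T i j k l = rot1 g (\<lambda>a. rot1 g (\<lambda>b. rot1 g (\<lambda>c. rot1 g (\<lambda>d. T a b c d) l) k) j) i"
  by (simp add: act4_def rot1_def sum_distrib_left mult_ac)

lemma act2_matrix_mult: "act2 g (act2 h A) = act2 (g ** h) A"
  by (intro ext) (simp add: act2_rot1 rot1_swap[of g h] rot1_matrix_mult)

lemma act4_matrix_mult: "act4 g (act4 h T) = act4 (g ** h) T"
  by (intro ext) (simp add: act4_rot1 rot1_swap[of g h] rot1_matrix_mult)

lemma rot1_mat_1: "rot1 (mat 1) X i = X i"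
proof -
  have "rot1 (mat 1) X i = (mat 1 *v (\<chi> a. X a)) $ i"
    unfolding rot1_def matrix_vector_mult_def by simp
  then show ?thesis by (simp add: matrix_vector_mul_lid)
qed

lemma act2_mat_1: "act2 (mat 1) A = A" and act4_mat_1: "act4 (mat 1) T = T"
  by (simp_all add: fun_eq_iff act2_rot1 act4_rot1 rot1_mat_1)

text \<open>The free indices are pulled out of the sums; then each swap of sums makes one repeated
  index innermost, where it can be contracted.\<close>

lemma dcontr42_act:
  assumes "orthogonal_matrix g"
  shows "dcontr42 (act4 g T) (act2 g A) = act2 g (dcontr42 T A)"
proof (intro ext)
  fix i j
  have "dcontr42 (act4 g T) (act2 g A) i j =
    (\<Sum>k\<in>UNIV. \<Sum>l\<in>UNIV. rot1 g (\<lambda>a. rot1 g (\<lambda>b. rot1 g (\<lambda>c. rot1 g (\<lambda>d. T a b c d) l) k * rot1 g (\<lambda>c. rot1 g (\<lambda>d. A c d) l) k) j) i)"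
    by (simp add: dcontr42_def act2_rot1 act4_rot1 rot1_mult_left)
  also have "\<dots> = rot1 g (\<lambda>a. rot1 g (\<lambda>b. \<Sum>k\<in>UNIV. \<Sum>l\<in>UNIV. rot1 g (\<lambda>c. rot1 g (\<lambda>d. T a b c d) l) k * rot1 g (\<lambda>c. rot1 g (\<lambda>d. A c d) l) k) j) i"
    by (simp only: rot1_sum)
  also have "\<dots> = rot1 g (\<lambda>a. rot1 g (\<lambda>b. \<Sum>l\<in>UNIV. \<Sum>k\<in>UNIV. rot1 g (\<lambda>c. rot1 g (\<lambda>d. T a b c d) l) k * rot1 g (\<lambda>c. rot1 g (\<lambda>d. A c d) l) k) j) i"
    by (subst sum.swap) simp
  also have "\<dots> = rot1 g (\<lambda>a. rot1 g (\<lambda>b. \<Sum>l\<in>UNIV. \<Sum>c\<in>UNIV. rot1 g (\<lambda>d. T a b c d) l * rot1 g (\<lambda>d. A c d) l) j) i"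
    by (simp only: rot1_contract[OF assms])
  also have "\<dots> = rot1 g (\<lambda>a. rot1 g (\<lambda>b. \<Sum>c\<in>UNIV. \<Sum>l\<in>UNIV. rot1 g (\<lambda>d. T a b c d) l * rot1 g (\<lambda>d. A c d) l) j) i"
    by (subst sum.swap) simp
  also have "\<dots> = act2 g (dcontr42 T A) i j"
    by (simp only: rot1_contract[OF assms] act2_rot1 dcontr42_def)
  finally show "dcontr42 (act4 g T) (act2 g A) i j = act2 g (dcontr42 T A) i j" .
qed

text \<open>With the last two indices of the second factor frozen, the product is a contraction of a
  fourth-order with a second-order tensor, which is already known to be equivariant.\<close>

lemma dcontr44_act:
  assumes "orthogonal_matrix g"
  shows "dcontr44 (act4 g S) (act4 g T) = act4 g (dcontr44 S T)"
proof (intro ext)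
  fix i j k l
  have slice: "dcontr44 P Q i j k l = dcontr42 P (\<lambda>m n. Q m n k l) i j" for P Q i j k l
    by (simp add: dcontr44_def dcontr42_def)
  have act_slice: "(\<lambda>m n. act4 g T m n k l)
      = act2 g (\<lambda>m n. rot1 g (\<lambda>c. rot1 g (\<lambda>d. T m n c d) l) k)"
    by (intro ext) (simp add: act4_rot1 act2_rot1)
  have contr: "dcontr42 S (\<lambda>m n. rot1 g (\<lambda>c. rot1 g (\<lambda>d. T m n c d) l) k) a b
      = rot1 g (\<lambda>c. rot1 g (\<lambda>d. dcontr44 S T a b c d) l) k" for a b
    unfolding dcontr42_def dcontr44_def by (simp only: rot1_mult_right rot1_sum)
  show "dcontr44 (act4 g S) (act4 g T) i j k l = act4 g (dcontr44 S T) i j k l"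
    by (simp add: slice act_slice dcontr42_act[OF assms])
      (simp add: act2_rot1 act4_rot1 contr)
qed

lemma tr13_act:
  assumes "orthogonal_matrix g"
  shows "tr13 (act4 g T) = act2 g (tr13 T)"
proof (intro ext)
  fix i j
  have diag: "(\<Sum>k\<in>UNIV. rot1 g (\<lambda>a. rot1 g (\<lambda>c. Y a c) k) k) = (\<Sum>a\<in>UNIV. Y a a)" for Y
  proof -
    have "(\<Sum>k\<in>UNIV. rot1 g (\<lambda>a. rot1 g (\<lambda>c. Y a c) k) k)
        = (\<Sum>k\<in>UNIV. \<Sum>a\<in>UNIV. g$k$a * rot1 g (\<lambda>c. Y a c) k)"
      by (simp add: rot1_def)
    also have "\<dots> = (\<Sum>a\<in>UNIV. \<Sum>k\<in>UNIV. g$k$a * rot1 g (\<lambda>c. Y a c) k)"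
      by (rule sum.swap)
    \<comment> \<open>The entry \<open>g$k$a\<close> is the rotated \<open>a\<close>-th basis
      vector, so the sum over \<open>k\<close> becomes an inner product of two rotated
      vectors.\<close>
    also have "\<dots> = (\<Sum>a\<in>UNIV. \<Sum>k\<in>UNIV. rot1 g (\<lambda>c. if c = a then 1 else 0) k * rot1 g (\<lambda>c. Y a c) k)"
      by (simp add: rot1_def if_distrib cong: if_cong)
    also have "\<dots> = (\<Sum>a\<in>UNIV. Y a a)"
      by (simp only: rot1_contract[OF assms]) (simp add: if_distrib if_distribR cong: if_cong)
    finally show ?thesis .
  qed
  have "tr13 (act4 g T) i j
      = (\<Sum>k\<in>UNIV. rot1 g (\<lambda>b. rot1 g (\<lambda>d. rot1 g (\<lambda>a. rot1 g (\<lambda>c. T a b c d) k) k) j) i)"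
  proof (simp only: tr13_def act4_rot1, rule sum.cong[OF refl])
    fix k
    have "rot1 g (\<lambda>a. rot1 g (\<lambda>b. rot1 g (\<lambda>c. rot1 g (\<lambda>d. T a b c d) j) k) i) k
      = rot1 g (\<lambda>b. rot1 g (\<lambda>a. rot1 g (\<lambda>c. rot1 g (\<lambda>d. T a b c d) j) k) k) i"
      by (rule rot1_swap)
    also have "\<dots> = rot1 g (\<lambda>b. rot1 g (\<lambda>a. rot1 g (\<lambda>d. rot1 g (\<lambda>c. T a b c d) k) j) k) i"
      by (subst (3) rot1_swap) simp
    also have "\<dots> = rot1 g (\<lambda>b. rot1 g (\<lambda>d. rot1 g (\<lambda>a. rot1 g (\<lambda>c. T a b c d) k) k) j) i"
      by (subst (2) rot1_swap) simp
    finally show "rot1 g (\<lambda>a. rot1 g (\<lambda>b. rot1 g (\<lambda>c. rot1 g (\<lambda>d. T a b c d) j) k) i) k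
      = rot1 g (\<lambda>b. rot1 g (\<lambda>d. rot1 g (\<lambda>a. rot1 g (\<lambda>c. T a b c d) k) k) j) i" .
  qed
  also have "\<dots> = act2 g (tr13 T) i j"
    by (simp only: rot1_sum diag act2_rot1 tr13_def)
  finally show "tr13 (act4 g T) i j = act2 g (tr13 T) i j" .
qed

lemma d2_act: "orthogonal_matrix g \<Longrightarrow> d2 (act4 g H) = act2 g (d2 H)"
  and c3_act: "orthogonal_matrix g \<Longrightarrow> c3 (act4 g H) = act2 g (c3 H)"
  and c4_act: "orthogonal_matrix g \<Longrightarrow> c4 (act4 g H) = act2 g (c4 H)"
  by (simp_all add: c4_def c3_def d2_def dcontr42_act dcontr44_act tr13_act)

section \<open>Rotations of harmonic tensors and conjugation of symmetries\<close>

lemma H4_sym: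
  assumes "T \<in> H4"
  shows "T i j k l = T j i k l" "T i j k l = T i k j l" "T i j k l = T i j l k"
  using assms unfolding H4_def by blast+

lemma H4_trace:
  assumes "T \<in> H4"
  shows "(\<Sum>i\<in>UNIV. T i i k l) = 0"
  using assms unfolding H4_def by blast

lemma act4_H4:
  assumes g: "orthogonal_matrix g" and T: "T \<in> H4"
  shows "act4 g T \<in> H4"
proof -
  have 1: "act4 g T i j k l = act4 g T j i k l" for i j k l
  proof -
    have "act4 g T i j k l = act4 g (\<lambda>a b. T b a) j i k l"
      unfolding act4_rot1 by (rule rot1_swap)
    moreover have "(\<lambda>a b. T b a) = T"
      by (intro ext) (rule H4_sym(1)[OF T])
    ultimately show ?thesis by simp
  qed
  have 2: "act4 g T i j k l = act4 g T i k j l" for i j k l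
  proof -
    have "act4 g T i j k l = act4 g (\<lambda>a b c. T a c b) i k j l"
      unfolding act4_rot1 by (intro arg_cong[of _ _ "\<lambda>X. rot1 g X i"] ext rot1_swap)
    moreover have "(\<lambda>a b c. T a c b) = T"
      by (intro ext) (rule H4_sym(2)[OF T])
    ultimately show ?thesis by simp
  qed
  have 3: "act4 g T i j k l = act4 g T i j l k" for i j k l
  proof -
    have "act4 g T i j k l = act4 g (\<lambda>a b c d. T a b d c) i j l k"
      unfolding act4_rot1
      by (intro arg_cong[of _ _ "\<lambda>X. rot1 g X i"] arg_cong[of _ _ "\<lambda>X. rot1 g X j"] ext rot1_swap)
    moreover have "(\<lambda>a b c d. T a b d c) = T"
      by (intro ext) (rule H4_sym(3)[OF T])
    ultimately show ?thesis by simp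
  qed
  have "(\<Sum>i\<in>UNIV. act4 g T i i k l) = 0" for k l
  proof -
    \<comment> \<open>Total symmetry makes all traces agree, so the equivariance of
      \<open>tr13\<close> can be used.\<close>
    have "(\<Sum>i\<in>UNIV. act4 g T i i k l) = tr13 (act4 g T) k l"
      unfolding tr13_def by (rule sum.cong) (simp_all only: 2)
    also have "tr13 T a b = 0" for a b
      unfolding tr13_def using H4_trace[OF T, of a b] by (simp only: H4_sym(2)[OF T, of _ a])
    then have "tr13 (act4 g T) k l = 0"
      by (simp add: tr13_act[OF g] act2_def)
    finally show ?thesis .
  qed
  with 1 2 3 show ?thesis unfolding H4_def by blast
qed

lemma SO3_orthogonal: "g \<in> SO3 \<Longrightarrow> orthogonal_matrix g"
  by (simp add: SO3_def)

lemma SO3_mult: "g \<in> SO3 \<Longrightarrow> h \<in> SO3 \<Longrightarrow> g ** h \<in> SO3"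
  by (simp add: SO3_def orthogonal_matrix_mul det_mul)

lemma SO3_transpose: "g \<in> SO3 \<Longrightarrow> transpose g \<in> SO3"
  by (simp add: SO3_def orthogonal_matrix_transpose det_transpose)

lemma SO3_mat_1: "mat 1 \<in> SO3"
  by (simp add: SO3_def orthogonal_matrix_id)

lemma SO3_transpose_mult: "g \<in> SO3 \<Longrightarrow> transpose g ** g = mat 1" "g \<in> SO3 \<Longrightarrow> g ** transpose g = mat 1"
  by (simp_all add: SO3_def orthogonal_matrix_def)

lemma SO3_row_inner:
  assumes "g \<in> SO3"
  shows "(\<Sum>a\<in>UNIV. g$i$a * g$j$a) = (if i = j then 1 else 0)"
proof -
  have "(g ** transpose g) $ i $ j = mat 1 $ i $ j" using assms by (simp add: SO3_transpose_mult)
  then show ?thesis by (simp add: matrix_matrix_mult_def transpose_def mat_def)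
qed

definition has_symmetry :: "tensor4 \<Rightarrow> bool" where
  "has_symmetry H \<longleftrightarrow> (\<exists>g\<in>SO3. g \<noteq> mat 1 \<and> act4 g H = H)"

text \<open>Conjugating by \<open>g\<close> carries a symmetry of the rotated tensor back to
  \<open>H\<close>. This is what lets later arguments choose an adapted frame.\<close>

lemma has_symmetry_act4:
  assumes g: "g \<in> SO3" and sym: "has_symmetry (act4 g H)"
  shows "has_symmetry H"
proof -
  obtain h where h: "h \<in> SO3" "h \<noteq> mat 1" "act4 h (act4 g H) = act4 g H"
    using sym unfolding has_symmetry_def by blast
  let ?k = "transpose g ** (h ** g)"
  have "act4 ?k H = act4 (transpose g) (act4 h (act4 g H))"
    by (simp add: act4_matrix_mult)
  also have "\<dots> = H"
    by (simp only: h(3)) (simp only: act4_matrix_mult SO3_transpose_mult[OF g] act4_mat_1)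
  finally have "act4 ?k H = H" .
  moreover have "?k \<noteq> mat 1"
  proof
    assume "?k = mat 1"
    then have "g ** ?k ** transpose g = mat 1"
      by (simp add: SO3_transpose_mult[OF g])
    moreover have "g ** ?k ** transpose g = (g ** transpose g) ** h ** (g ** transpose g)"
      by (simp add: matrix_mul_assoc)
    ultimately show False using h(2) by (simp add: SO3_transpose_mult[OF g])
  qed
  moreover have "?k \<in> SO3" by (intro SO3_mult SO3_transpose g h)
  ultimately show ?thesis unfolding has_symmetry_def by blast
qed

section \<open>Components of harmonic tensors\<close>

text \<open>Nine independent components, matching the dimension of the space; index symmetry and the
  trace conditions give the others. The groups \<open>b, c\<close>, then \<open>p, q\<close>, then
  \<open>s, t\<close> belong to the index pairs 12, 13 and 23.\<close>

definition harmonic_coords ::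
  "tensor4 \<Rightarrow> real \<Rightarrow> real \<Rightarrow> real \<Rightarrow> real \<Rightarrow> real \<Rightarrow> real \<Rightarrow> real \<Rightarrow> real \<Rightarrow> real \<Rightarrow> bool" where
  "harmonic_coords H x y z b c p q s t \<longleftrightarrow> H \<in> H4 \<and>
     H 2 2 3 3 = x \<and> H 1 1 3 3 = y \<and> H 1 1 2 2 = z \<and> H 1 1 1 2 = b \<and> H 1 2 2 2 = c \<and>
     H 1 1 1 3 = p \<and> H 1 2 2 3 = q \<and> H 1 1 2 3 = s \<and> H 2 2 2 3 = t"

lemma harmonic_coords_traces:
  assumes "harmonic_coords H x y z b c p q s t"
  shows "H 1 1 1 1 = - (y + z)" "H 2 2 2 2 = - (x + z)" "H 3 3 3 3 = - (x + y)"
    "H 1 2 3 3 = - (b + c)" "H 1 3 3 3 = - (p + q)" "H 2 3 3 3 = - (s + t)"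
proof -
  have H: "H \<in> H4" and coords: "H 2 2 3 3 = x" "H 1 1 3 3 = y" "H 1 1 2 2 = z" "H 1 1 1 2 = b"
     "H 1 2 2 2 = c" "H 1 1 1 3 = p" "H 1 2 2 3 = q" "H 1 1 2 3 = s" "H 2 2 2 3 = t"
    using assms unfolding harmonic_coords_def by auto
  note tr = H4_trace[OF H, unfolded sum_3]
  have perm: "H 2 2 1 1 = H 1 1 2 2" "H 3 3 1 1 = H 1 1 3 3" "H 3 3 2 2 = H 2 2 3 3"
      "H 2 2 1 2 = H 1 2 2 2" "H 3 3 1 2 = H 1 2 3 3"
      "H 2 2 1 3 = H 1 2 2 3" "H 3 3 1 3 = H 1 3 3 3"
      "H 3 3 2 3 = H 2 3 3 3"
    by (metis H4_sym[OF H])+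
  show "H 1 1 1 1 = - (y + z)" "H 2 2 2 2 = - (x + z)" "H 3 3 3 3 = - (x + y)"
    "H 1 2 3 3 = - (b + c)" "H 1 3 3 3 = - (p + q)" "H 2 3 3 3 = - (s + t)"
    using tr[of 1 1] tr[of 2 2] tr[of 3 3] tr[of 1 2] tr[of 1 3] tr[of 2 3] coords perm
    by linarith+
qed

lemma harmonic_coords_exist:
  assumes "H \<in> H4"
  obtains x y z b c p q s t where "harmonic_coords H x y z b c p q s t"
  using assms unfolding harmonic_coords_def by blast

lemma d2_contraction:
  assumes "H \<in> H4"
  shows "d2 H i j = (\<Sum>k\<in>UNIV. \<Sum>m\<in>UNIV. \<Sum>n\<in>UNIV. H i k m n * H j k m n)"
proof -
  have "H k i m n = H i k m n" "H m n k j = H j k m n" for k m n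
    by (metis H4_sym[OF assms])+
  then show ?thesis by (simp add: d2_def tr13_def dcontr44_def)
qed

text \<open>As rewrite rules these swap adjacent descending indices, which brings every component
  into sorted form.\<close>

lemma H4_unsorted:
  assumes "H \<in> H4"
  shows "H i 2 1 k = H i 1 2 k" "H i 3 1 k = H i 1 3 k" "H i 3 2 k = H i 2 3 k"
    "H i k 2 1 = H i k 1 2" "H i k 3 1 = H i k 1 3" "H i k 3 2 = H i k 2 3"
    "H 2 1 i k = H 1 2 i k" "H 3 1 i k = H 1 3 i k" "H 3 2 i k = H 2 3 i k"
  by (metis H4_sym[OF assms])+

lemma d2_coords:
  assumes "harmonic_coords H x y z b c p q s t"
  shows
    "d2 H 1 2 = b * (2*z - 4*y - 3*x) + c * (2*z - 4*x - 3*y) + (p + q) * (s + t) + 3*p* s + 3*q*t + 6*q* s"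
    "d2 H 1 3 = p * (x - z) + q * (4*x - 2*y + 3*z) + (4*c + 3*b) * t - 3*c* s"
    "d2 H 2 3 = t * (y - z) + s * (4*y - 2*x + 3*z) + (4*b + 3*c) * p - 3*b*q"
    "d2 H 1 1 = (y + z)\<^sup>2 + c\<^sup>2 + (p + q)\<^sup>2 + 3*b\<^sup>2 + 3*p\<^sup>2 + 3*z\<^sup>2 + 3*q\<^sup>2 + 3*y\<^sup>2 + 3*(b + c)\<^sup>2 + 6* s\<^sup>2"
    "d2 H 2 2 = b\<^sup>2 + (x + z)\<^sup>2 + (s + t)\<^sup>2 + 3*z\<^sup>2 + 3* s\<^sup>2 + 3*c\<^sup>2 + 3*t\<^sup>2 + 3*(b + c)\<^sup>2 + 3*x\<^sup>2 + 6*q\<^sup>2"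
    "d2 H 3 3 = p\<^sup>2 + t\<^sup>2 + (x + y)\<^sup>2 + 3* s\<^sup>2 + 3*y\<^sup>2 + 3*q\<^sup>2 + 3*x\<^sup>2 + 3*(p + q)\<^sup>2 + 3*(s + t)\<^sup>2 + 6*(b + c)\<^sup>2"
proof -
  have H: "H \<in> H4" and coords: "H 2 2 3 3 = x" "H 1 1 3 3 = y" "H 1 1 2 2 = z" "H 1 1 1 2 = b"
     "H 1 2 2 2 = c" "H 1 1 1 3 = p" "H 1 2 2 3 = q" "H 1 1 2 3 = s" "H 2 2 2 3 = t"
    using assms unfolding harmonic_coords_def by auto
  note simps = d2_contraction[OF H] sum_3 H4_unsorted[OF H] coords harmonic_coords_traces[OF assms]
    power2_eq_square
  show  "d2 H 1 2 = b * (2*z - 4*y - 3*x) + c * (2*z - 4*x - 3*y) + (p + q) * (s + t) + 3*p* s + 3*q*t + 6*q* s"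
    by (simp add: simps) (simp add: algebra_simps)
  show "d2 H 1 3 = p * (x - z) + q * (4*x - 2*y + 3*z) + (4*c + 3*b) * t - 3*c* s"
    by (simp add: simps) (simp add: algebra_simps)
  show "d2 H 2 3 = t * (y - z) + s * (4*y - 2*x + 3*z) + (4*b + 3*c) * p - 3*b*q"
    by (simp add: simps) (simp add: algebra_simps)
  show     "d2 H 1 1 = (y + z)\<^sup>2 + c\<^sup>2 + (p + q)\<^sup>2 + 3*b\<^sup>2 + 3*p\<^sup>2 + 3*z\<^sup>2 + 3*q\<^sup>2 + 3*y\<^sup>2 + 3*(b + c)\<^sup>2 + 6* s\<^sup>2"
    "d2 H 2 2 = b\<^sup>2 + (x + z)\<^sup>2 + (s + t)\<^sup>2 + 3*z\<^sup>2 + 3* s\<^sup>2 + 3*c\<^sup>2 + 3*t\<^sup>2 + 3*(b + c)\<^sup>2 + 3*x\<^sup>2 + 6*q\<^sup>2"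
    "d2 H 3 3 = p\<^sup>2 + t\<^sup>2 + (x + y)\<^sup>2 + 3* s\<^sup>2 + 3*y\<^sup>2 + 3*q\<^sup>2 + 3*x\<^sup>2 + 3*(p + q)\<^sup>2 + 3*(s + t)\<^sup>2 + 6*(b + c)\<^sup>2"
    by ((simp add: simps), (simp add: algebra_simps))+
qed

lemma Sym2_commute: "A \<in> Sym2 \<Longrightarrow> A i j = A j i"
  by (simp add: Sym2_def)

lemma dcontr42_coords:
  assumes "harmonic_coords H x y z b c p q s t" and A: "A \<in> Sym2"
  shows
    "dcontr42 H A 1 2 = b * (A 1 1 - A 3 3) + c * (A 2 2 - A 3 3) + 2*z * A 1 2 + 2* s * A 1 3 + 2*q * A 2 3"
    "dcontr42 H A 1 3 = p * (A 1 1 - A 3 3) + q * (A 2 2 - A 3 3) + 2* s * A 1 2 + 2*y * A 1 3 - 2*(b + c) * A 2 3"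
    "dcontr42 H A 2 3 = s * (A 1 1 - A 3 3) + t * (A 2 2 - A 3 3) + 2*q * A 1 2 - 2*(b + c) * A 1 3 + 2*x * A 2 3"
    "dcontr42 H A 1 1 = - (y + z) * A 1 1 + z * A 2 2 + y * A 3 3 + 2*b * A 1 2 + 2*p * A 1 3 + 2* s * A 2 3"
    "dcontr42 H A 2 2 = z * A 1 1 - (x + z) * A 2 2 + x * A 3 3 + 2*c * A 1 2 + 2*q * A 1 3 + 2*t * A 2 3"
    "dcontr42 H A 3 3 = y * A 1 1 + x * A 2 2 - (x + y) * A 3 3 - 2*(b + c) * A 1 2 - 2*(p + q) * A 1 3 - 2*(s + t) * A 2 3"
proof -
  have H: "H \<in> H4" and coords: "H 2 2 3 3 = x" "H 1 1 3 3 = y" "H 1 1 2 2 = z" "H 1 1 1 2 = b"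
     "H 1 2 2 2 = c" "H 1 1 1 3 = p" "H 1 2 2 3 = q" "H 1 1 2 3 = s" "H 2 2 2 3 = t"
    using assms unfolding harmonic_coords_def by auto
  note simps = dcontr42_def sum_3 H4_unsorted[OF H] coords harmonic_coords_traces[OF assms(1)]
    Sym2_commute[OF A, of 2 1] Sym2_commute[OF A, of 3 1] Sym2_commute[OF A, of 3 2]
  show
    "dcontr42 H A 1 2 = b * (A 1 1 - A 3 3) + c * (A 2 2 - A 3 3) + 2*z * A 1 2 + 2* s * A 1 3 + 2*q * A 2 3"
    "dcontr42 H A 1 3 = p * (A 1 1 - A 3 3) + q * (A 2 2 - A 3 3) + 2* s * A 1 2 + 2*y * A 1 3 - 2*(b + c) * A 2 3"
    "dcontr42 H A 2 3 = s * (A 1 1 - A 3 3) + t * (A 2 2 - A 3 3) + 2*q * A 1 2 - 2*(b + c) * A 1 3 + 2*x * A 2 3"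
    "dcontr42 H A 1 1 = - (y + z) * A 1 1 + z * A 2 2 + y * A 3 3 + 2*b * A 1 2 + 2*p * A 1 3 + 2* s * A 2 3"
    "dcontr42 H A 2 2 = z * A 1 1 - (x + z) * A 2 2 + x * A 3 3 + 2*c * A 1 2 + 2*q * A 1 3 + 2*t * A 2 3"
    "dcontr42 H A 3 3 = y * A 1 1 + x * A 2 2 - (x + y) * A 3 3 - 2*(b + c) * A 1 2 - 2*(p + q) * A 1 3 - 2*(s + t) * A 2 3"
    by ((simp add: simps), (simp add: algebra_simps)?)+
qed

section \<open>Half-turns and adapted frames\<close>

definition half_turn :: "3 \<Rightarrow> real^3^3" where
  "half_turn n = (\<chi> i j. if i = j then (if i = n then 1 else - 1) else 0)"

lemma half_turn_SO3: "half_turn n \<in> SO3"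
proof -
  have "transpose (half_turn n) ** half_turn n = mat 1"
    by (simp add: vec_eq_iff matrix_matrix_mult_def transpose_def half_turn_def mat_def sum_3 forall_3)
  moreover have "det (half_turn n) = 1"
    using exhaust_3[of n] by (auto simp: det_3 half_turn_def)
  ultimately show ?thesis by (simp add: SO3_def orthogonal_matrix)
qed

lemma half_turn_neq_id: "half_turn n \<noteq> mat 1"
proof
  assume "half_turn n = mat 1"
  then have "half_turn n $ i $ i = 1" for i by (simp add: mat_def)
  \<comment> \<open>Addition in the type \<open>3\<close> is cyclic, so \<open>n + 1\<close> is an
    index other than \<open>n\<close>, with diagonal entry -1.\<close>
  from this[of "n + 1"] show False
    using exhaust_3[of n] by (auto simp: half_turn_def)
qed

lemma rot1_half_turn: "rot1 (half_turn n) X i = (if i = n then X i else - X i)"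
  using exhaust_3[of i] by (auto simp: rot1_def half_turn_def sum_3)

lemma has_symmetry_half_turn:
  assumes "\<And>i j k l. rot1 (half_turn n) (\<lambda>a. rot1 (half_turn n) (\<lambda>b. rot1 (half_turn n)
      (\<lambda>c. rot1 (half_turn n) (\<lambda>d. H a b c d) l) k) j) i = H i j k l"
  shows "has_symmetry H"
  using assms half_turn_SO3 half_turn_neq_id
  unfolding has_symmetry_def by (metis act4_rot1 ext)

text \<open>A component is odd under the half-turn about an axis exactly when that axis occurs an
  odd number of times among its indices. The three claims remove the odd components for the axes 3,
  2 and 1.\<close>

lemma has_symmetry_coords:
  assumes "harmonic_coords H x y z b c p q s t"
  shows "p = 0 \<Longrightarrow> q = 0 \<Longrightarrow> s = 0 \<Longrightarrow> t = 0 \<Longrightarrow> has_symmetry H"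
    and "b = 0 \<Longrightarrow> c = 0 \<Longrightarrow> s = 0 \<Longrightarrow> t = 0 \<Longrightarrow> has_symmetry H"
    and "b = 0 \<Longrightarrow> c = 0 \<Longrightarrow> p = 0 \<Longrightarrow> q = 0 \<Longrightarrow> has_symmetry H"
proof -
  have H: "H \<in> H4" and coords: "H 2 2 3 3 = x" "H 1 1 3 3 = y" "H 1 1 2 2 = z" "H 1 1 1 2 = b"
     "H 1 2 2 2 = c" "H 1 1 1 3 = p" "H 1 2 2 3 = q" "H 1 1 2 3 = s" "H 2 2 2 3 = t"
    using assms unfolding harmonic_coords_def by auto
  note simps = rot1_half_turn H4_unsorted[OF H] coords harmonic_coords_traces[OF assms]
  have all: "\<forall>i j k l. rot1 (half_turn n) (\<lambda>a. rot1 (half_turn n) (\<lambda>b. rot1 (half_turn n)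
      (\<lambda>c. rot1 (half_turn n) (\<lambda>d. H a b c d) l) k) j) i = H i j k l \<Longrightarrow> has_symmetry H" for n
    using has_symmetry_half_turn[of n H] by blast
  show "has_symmetry H" if "p = 0" "q = 0" "s = 0" "t = 0"
    by (rule all[of 3]) (use that in \<open>simp add: forall_3 simps\<close>)
  show "has_symmetry H" if "b = 0" "c = 0" "s = 0" "t = 0"
    by (rule all[of 2]) (use that in \<open>simp add: forall_3 simps\<close>)
  show "has_symmetry H" if "b = 0" "c = 0" "p = 0" "q = 0"
    by (rule all[of 1]) (use that in \<open>simp add: forall_3 simps\<close>)
qed

section \<open>Rotations about the third axis, and angles that annihilate a component\<close>

definition rotz :: "real \<Rightarrow> real^3^3" where
  "rotz \<theta> = vector [vector [cos \<theta>, - sin \<theta>, 0], vector [sin \<theta>, cos \<theta>, 0], vector [0, 0, 1]]"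

lemma rotz_SO3: "rotz \<theta> \<in> SO3"
proof -
  have "transpose (rotz \<theta>) ** rotz \<theta> = mat 1"
    by (simp add: vec_eq_iff matrix_matrix_mult_def transpose_def rotz_def mat_def sum_3 forall_3
        flip: power2_eq_square)
  moreover have "det (rotz \<theta>) = 1"
    by (simp add: det_3 rotz_def flip: power2_eq_square)
  ultimately show ?thesis by (simp add: SO3_def orthogonal_matrix)
qed

lemma rot1_rotz:
  "rot1 (rotz \<theta>) X 1 = cos \<theta> * X 1 - sin \<theta> * X 2"
  "rot1 (rotz \<theta>) X 2 = sin \<theta> * X 1 + cos \<theta> * X 2"
  "rot1 (rotz \<theta>) X 3 = X 3"
  by (simp_all add: rot1_def rotz_def sum_3)

lemma antiperiodic_zero:
  fixes f :: "real \<Rightarrow> real"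
  assumes "continuous_on UNIV f" "0 \<le> d" "f d = - f 0"
  obtains \<theta> where "f \<theta> = 0"
proof -
  have cont: "continuous_on {0..d} f" using assms(1) continuous_on_subset by blast
  have "\<exists>\<theta>. f \<theta> = 0"
  proof (cases "f 0 \<le> 0")
    case True
    then show ?thesis using IVT'[of f 0 0 d] assms cont by auto
  next
    case False
    then show ?thesis using IVT2'[of f d 0 0] assms cont by auto
  qed
  with that show ?thesis by blast
qed

text \<open>Three of the indices lie in the rotated plane, so turning by \<open>pi\<close> reverses
  the sign.\<close>

lemma rotz_zero_1123:
  obtains \<theta> where "act4 (rotz \<theta>) H 1 1 2 3 = 0"
proof (rule antiperiodic_zero[of "\<lambda>\<theta>. act4 (rotz \<theta>) H 1 1 2 3" pi])
  show "continuous_on UNIV (\<lambda>\<theta>. act4 (rotz \<theta>) H 1 1 2 3)"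
    unfolding act4_rot1 rot1_rotz by (intro continuous_intros)
qed (simp_all add: act4_rot1 rot1_rotz)

text \<open>A quarter turn exchanges the indices 1 and 2 with one change of sign.\<close>

lemma rotz_zero_1233:
  assumes "H \<in> H4"
  obtains \<theta> where "act4 (rotz \<theta>) H 1 2 3 3 = 0"
proof (rule antiperiodic_zero[of "\<lambda>\<theta>. act4 (rotz \<theta>) H 1 2 3 3" "pi / 2"])
  show "continuous_on UNIV (\<lambda>\<theta>. act4 (rotz \<theta>) H 1 2 3 3)"
    unfolding act4_rot1 rot1_rotz by (intro continuous_intros)
qed (simp_all add: act4_rot1 rot1_rotz H4_unsorted[OF assms])

lemma rotz_zero_12:
  assumes "A \<in> Sym2"
  obtains \<theta> where "act2 (rotz \<theta>) A 1 2 = 0"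
proof (rule antiperiodic_zero[of "\<lambda>\<theta>. act2 (rotz \<theta>) A 1 2" "pi / 2"])
  show "continuous_on UNIV (\<lambda>\<theta>. act2 (rotz \<theta>) A 1 2)"
    unfolding act2_rot1 rot1_rotz by (intro continuous_intros)
  show "act2 (rotz (pi / 2)) A 1 2 = - act2 (rotz 0) A 1 2"
    using assms unfolding Sym2_def by (simp add: act2_rot1 rot1_rotz)
qed simp_all

lemma SO3_with_row:
  assumes "norm n = 1"
  obtains g where "g \<in> SO3" "g $ 3 = n"
proof -
  obtain A :: "real^3^3" where A: "rotation_matrix A" "A *v axis 3 1 = n"
    using rotation_matrix_exists_basis[of n 3] assms by auto
  have "transpose A \<in> SO3"
    using A(1) by (intro SO3_transpose) (simp add: SO3_def rotation_matrix_def)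
  moreover have "transpose A $ 3 = n"
    using A(2) by (simp add: transpose_def matrix_vector_mult_basis column_def vec_eq_iff)
  ultimately show ?thesis using that by blast
qed

lemma SO3_row_norm:
  assumes "g \<in> SO3"
  shows "norm (g $ i) = 1"
  using assms by (simp add: SO3_def orthogonal_matrix_orthonormal_rows row_def)

section \<open>The quartic form of a tensor and its maximum on the sphere\<close>

definition quartic :: "tensor4 \<Rightarrow> real^3 \<Rightarrow> real" where
  "quartic H u = (\<Sum>a\<in>UNIV. \<Sum>b\<in>UNIV. \<Sum>c\<in>UNIV. \<Sum>d\<in>UNIV. u$a * u$b * u$c * u$d * H a b c d)"

lemma act4_3333: "act4 g H 3 3 3 3 = quartic H (g $ 3)"
  by (simp add: act4_def quartic_def)

text \<open>The left-hand side is a binary quartic form restricted to the unit circle. It attains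
  its maximum \<open>k0\<close> at angle 0, where its derivative is \<open>4 * k1\<close>.\<close>

lemma circle_max_critical:
  fixes k0 k1 k2 k3 k4 :: real
  assumes "\<And>\<theta>. k0 * cos \<theta> ^ 4 + 4 * k1 * cos \<theta> ^ 3 * sin \<theta> + 6 * k2 * cos \<theta> ^ 2 * sin \<theta> ^ 2
    + 4 * k3 * cos \<theta> * sin \<theta> ^ 3 + k4 * sin \<theta> ^ 4 \<le> k0"
  shows "k1 = 0"
proof -
  let ?f = "\<lambda>\<theta>. k0 * cos \<theta> ^ 4 + 4 * k1 * cos \<theta> ^ 3 * sin \<theta> + 6 * k2 * cos \<theta> ^ 2 * sin \<theta> ^ 2
    + 4 * k3 * cos \<theta> * sin \<theta> ^ 3 + k4 * sin \<theta> ^ 4"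
  have "(?f has_real_derivative 4 * k1) (at 0)"
    by (auto intro!: derivative_eq_intros)
  from DERIV_local_max[OF this, of 1] show ?thesis using assms by simp
qed

text \<open>The third frame vector maximises the quartic form. Criticality along the great circles
  towards the other two frame vectors gives the two equations.\<close>

lemma critical_frame:
  assumes "H \<in> H4"
  obtains g where "g \<in> SO3" "act4 g H 1 3 3 3 = 0" "act4 g H 2 3 3 3 = 0"
proof -
  have "continuous_on (sphere 0 1) (quartic H)"
    unfolding quartic_def by (intro continuous_intros)
  then obtain n where n: "norm n = 1" "\<And>u. norm u = 1 \<Longrightarrow> quartic H u \<le> quartic H n"
    using continuous_attains_sup[of "sphere 0 1" "quartic H"] by auto
  obtain g where g: "g \<in> SO3" "g $ 3 = n" using SO3_with_row n(1) by blast
  let ?H = "act4 g H"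
  have H4: "?H \<in> H4" using act4_H4 SO3_orthogonal g(1) assms by blast
  have max: "quartic ?H u \<le> ?H 3 3 3 3" if u: "norm u = 1" for u
  proof -
    obtain h where h: "h \<in> SO3" "h $ 3 = u" using SO3_with_row u by blast
    have "quartic ?H u = act4 (h ** g) H 3 3 3 3"
      by (simp only: act4_3333[symmetric] h(2)[symmetric] act4_matrix_mult)
    also have "\<dots> \<le> quartic H n"
      unfolding act4_3333 by (intro n(2) SO3_row_norm SO3_mult h g)
    finally show ?thesis by (simp add: act4_3333 g(2))
  qed
  have "?H 1 3 3 3 = 0"
  proof (rule circle_max_critical)
    fix \<theta>
    have "norm (vector [sin \<theta>, 0, cos \<theta>] :: real^3) = 1"
      by (simp add: norm_vec_def L2_set_def sum_3)
    from max[OF this] show "?H 3 3 3 3 * cos \<theta> ^ 4 + 4 * ?H 1 3 3 3 * cos \<theta> ^ 3 * sin \<theta>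
       + 6 * ?H 1 1 3 3 * cos \<theta> ^ 2 * sin \<theta> ^ 2
       + 4 * ?H 1 1 1 3 * cos \<theta> * sin \<theta> ^ 3 + ?H 1 1 1 1 * sin \<theta> ^ 4 \<le> ?H 3 3 3 3"
      by (simp add: quartic_def sum_3 H4_unsorted[OF H4] algebra_simps power_numeral_reduce)
  qed
  moreover have "?H 2 3 3 3 = 0"
  proof (rule circle_max_critical)
    fix \<theta>
    have "norm (vector [0, sin \<theta>, cos \<theta>] :: real^3) = 1"
      by (simp add: norm_vec_def L2_set_def sum_3)
    from max[OF this] show "?H 3 3 3 3 * cos \<theta> ^ 4 + 4 * ?H 2 3 3 3 * cos \<theta> ^ 3 * sin \<theta>
       + 6 * ?H 2 2 3 3 * cos \<theta> ^ 2 * sin \<theta> ^ 2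
       + 4 * ?H 2 2 2 3 * cos \<theta> * sin \<theta> ^ 3 + ?H 2 2 2 2 * sin \<theta> ^ 4 \<le> ?H 3 3 3 3"
      by (simp add: quartic_def sum_3 H4_unsorted[OF H4] algebra_simps power_numeral_reduce)
  qed
  ultimately show ?thesis using that g(1) by blast
qed

section \<open>Tensors with an exceptional second-order covariant\<close>

lemma d2_Sym2: "H \<in> H4 \<Longrightarrow> d2 H \<in> Sym2"
  by (simp add: Sym2_def d2_contraction mult.commute)

lemma dcontr42_Sym2: "H \<in> H4 \<Longrightarrow> dcontr42 H A \<in> Sym2"
  by (simp add: Sym2_def dcontr42_def H4_sym(1)[of H])

lemma act2_rotz_13_23:
  assumes "A 1 3 = 0" "A 2 3 = 0"
  shows "act2 (rotz \<theta>) A 1 3 = 0" "act2 (rotz \<theta>) A 2 3 = 0"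
  using assms by (simp_all add: act2_rot1 rot1_rotz)

text \<open>The hypotheses make \<open>H i j 3 3\<close> axially symmetric, so they survive a
  rotation about the third axis that removes \<open>H 1 1 2 3\<close>. The (2,3) entry of
  \<open>d2\<close> then reduces to \<open>4 * b * p\<close>, and either factor vanishing leaves a
  half-turn.\<close>

lemma has_symmetry_axial:
  assumes H: "H \<in> H4" and "H 1 3 3 3 = 0" "H 2 3 3 3 = 0" "H 1 2 3 3 = 0" "H 1 1 3 3 = H 2 2 3 3"
    and "d2 H 1 3 = 0" "d2 H 2 3 = 0"
  shows "has_symmetry H"
proof -
  obtain \<theta> where \<theta>: "act4 (rotz \<theta>) H 1 1 2 3 = 0" by (rule rotz_zero_1123)
  let ?H = "act4 (rotz \<theta>) H"
  have H': "?H \<in> H4" using act4_H4 SO3_orthogonal rotz_SO3 H by blast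
  have 1: "?H 1 3 3 3 = 0" "?H 2 3 3 3 = 0" "?H 1 2 3 3 = 0" "?H 1 1 3 3 = ?H 2 2 3 3"
    using assms by (simp_all add: act4_rot1 rot1_rotz H4_unsorted[OF H] algebra_simps)
  have 2: "d2 ?H 1 3 = 0" "d2 ?H 2 3 = 0"
    using assms by (simp_all add: d2_act SO3_orthogonal rotz_SO3 act2_rotz_13_23)
  obtain x y z b c p q s t where co: "harmonic_coords ?H x y z b c p q s t"
    using harmonic_coords_exist H' by blast
  have "q = - p" "t = - s" "c = - b" "x = y" "s = 0"
    using 1 \<theta> harmonic_coords_traces[OF co] co unfolding harmonic_coords_def by linarith+
  then have eqs: "s = 0" "t = 0" "c = - b" "q = - p" and "p * b = 0"
    using 2 d2_coords(2,3)[OF co] by (auto simp: algebra_simps)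
  then consider "p = 0" | "b = 0" by auto
  then have "has_symmetry ?H"
    by cases (use has_symmetry_coords[OF co] eqs in simp_all)
  then show ?thesis using has_symmetry_act4 rotz_SO3 by blast
qed

lemma has_symmetry_d2_scalar:
  assumes H: "H \<in> H4" and scalar: "\<And>i j. d2 H i j = (if i = j then k else 0)"
  shows "has_symmetry H"
proof -
  have act_scalar: "act2 g (d2 H) = d2 H" if "g \<in> SO3" for g
    by (intro ext) (simp add: act2_def scalar if_distrib sum_distrib_right[symmetric]
        SO3_row_inner[OF that] cong: if_cong)
  obtain g where g: "g \<in> SO3" "act4 g H 1 3 3 3 = 0" "act4 g H 2 3 3 3 = 0"
    using critical_frame[OF H] by blast
  let ?G = "act4 g H"
  have G: "?G \<in> H4" using act4_H4 SO3_orthogonal g H by blast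
  obtain \<theta> where \<theta>: "act4 (rotz \<theta>) ?G 1 2 3 3 = 0" using rotz_zero_1233[OF G] .
  let ?H = "act4 (rotz \<theta>) ?G"
  have H': "?H \<in> H4" using act4_H4 SO3_orthogonal rotz_SO3 G by blast
  have 1: "?H 1 3 3 3 = 0" "?H 2 3 3 3 = 0"
    unfolding act4_rot1[of "rotz \<theta>"] rot1_rotz using g(2,3) by simp_all
  have d: "d2 ?H i j = (if i = j then k else 0)" for i j
    by (simp add: d2_act SO3_orthogonal rotz_SO3 g(1) act_scalar scalar)
  have "has_symmetry ?H"
  proof (cases "?H 1 1 3 3 = ?H 2 2 3 3")
    case True
    then show ?thesis by (intro has_symmetry_axial H' 1 \<theta>) (simp_all add: d)
  next
    case False
    obtain x y z b c p q s t where co: "harmonic_coords ?H x y z b c p q s t"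
      using harmonic_coords_exist H' by blast
    have eqs: "q = - p" "t = - s" "c = - b"
      using 1 \<theta> harmonic_coords_traces[OF co] by linarith+
    have xy: "x \<noteq> y" using False co unfolding harmonic_coords_def by simp
    have "b * (x - y) = 0"
      using d2_coords(1)[OF co] d[of 1 2] eqs by (auto simp: algebra_simps)
    then have b: "b = 0" using xy by simp
    then have c: "c = 0" using eqs by simp
    have "(y - x) * (4*x + 4*y + 2*z) = d2 ?H 1 1 - d2 ?H 2 2"
      unfolding d2_coords[OF co] eqs b by (simp add: algebra_simps power2_eq_square)
    then have "(y - x) * (4*x + 4*y + 2*z) = 0" by (simp add: d)
    then have z: "z = - 2 * (x + y)" using xy by simp
    have "p * (x + 2*y) = 0" "s * (y + 2*x) = 0"
      using d2_coords(2,3)[OF co] d[of 1 3] d[of 2 3] unfolding eqs b z by (simp_all add: algebra_simps)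
    \<comment> \<open>If both were nonzero, then \<open>x = - 2 * y\<close> and
      \<open>y = - 2 * x\<close>, hence \<open>x = y = 0\<close>.\<close>
    then have "p = 0 \<or> s = 0" using xy by auto
    then show ?thesis using has_symmetry_coords(2,3)[OF co] eqs b c by auto
  qed
  then show ?thesis using has_symmetry_act4 rotz_SO3 g(1) by blast
qed

text \<open>Up to a scalar, which \<open>H\<close> annihilates, \<open>d2 H\<close> is a nonzero
  multiple of the square of the third basis vector. Hence \<open>c3 H\<close> is a multiple of
  \<open>H i j 3 3\<close>, and the affine relation makes the latter axially symmetric.\<close>

lemma has_symmetry_diag_axial:
  assumes H: "H \<in> H4" and c3: "\<And>i j. c3 H i j = l * d2 H i j + (if i = j then m else 0)"
    and d: "d2 H 1 2 = 0" "d2 H 1 3 = 0" "d2 H 2 3 = 0"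
    and eq: "d2 H 1 1 = d2 H 2 2" and neq: "d2 H 1 1 \<noteq> d2 H 3 3"
  shows "has_symmetry H"
proof -
  obtain x y z b c p q s t where co: "harmonic_coords H x y z b c p q s t"
    using harmonic_coords_exist H by blast
  define w where "w = d2 H 1 1 - d2 H 3 3"
  have w: "w \<noteq> 0" "d2 H 3 3 = d2 H 2 2 - w" "d2 H 1 1 = d2 H 2 2" using eq neq by (auto simp: w_def)
  note C = dcontr42_coords[OF co d2_Sym2[OF H], folded c3_def, unfolded c3 d w]
  have "(b + c) * w = 0" "(p + q) * w = 0" "(s + t) * w = 0"
    using C(1-3) by (simp_all add: algebra_simps)
  moreover have "(x - y) * w = 0"
    using C(4,5) by (auto simp: algebra_simps)
  ultimately have "b + c = 0" "p + q = 0" "s + t = 0" "x = y" using w(1) by simp_all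
  then show ?thesis using harmonic_coords_traces[OF co] co
    by (intro has_symmetry_axial H d) (auto simp: harmonic_coords_def)
qed

text \<open>The second factor is \<open>d2 H 1 1 - d2 H 2 2\<close> when \<open>d2 H\<close> is a diagonal eigenvector of \<open>H\<close>; the hypotheses on
  \<open>r1, r2, r3\<close> express the vanishing of the off-diagonal entries of \<open>d2 H\<close> when all three are nonzero.\<close>
lemma diagonal_eigen_identity:
  fixes T m w1 w2 w3 r1 r2 r3 :: real
  assumes w: "w1 + w2 + w3 = 0"
    and r3: "r3\<^sup>2 * (w1 * w2) = (T * w1\<^sup>2 + 5*m) * (T * w2\<^sup>2 + 5*m)"
    and r2: "r2\<^sup>2 * (w1 * w3) = (T * w1\<^sup>2 + 5*m) * (T * w3\<^sup>2 + 5*m)"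
    and r1: "r1\<^sup>2 * (w2 * w3) = (T * w2\<^sup>2 + 5*m) * (T * w3\<^sup>2 + 5*m)"
    and x: "x = T * (w2 * w3) - 4*m" and y: "y = T * (w1 * w3) - 4*m" and z: "z = T * (w1 * w2) - 4*m"
  shows "w1 * w2 * w3 * ((y - x) * (4*x + 4*y + 2*z)
     - 2 * w3 * (r3\<^sup>2 * (w1 - w2) + r2\<^sup>2 * (2*w1 - w2) + r1\<^sup>2 * (w1 - 2*w2))) = 0"
proof -
  \<comment> \<open>The prefactor is distributed so that each square appears in the product fixed by
    its hypothesis; eliminating \<open>w3\<close> then leaves a polynomial identity.\<close>
  have "w1 * w2 * w3 * ((y - x) * (4*x + 4*y + 2*z)
     - 2 * w3 * (r3\<^sup>2 * (w1 - w2) + r2\<^sup>2 * (2*w1 - w2) + r1\<^sup>2 * (w1 - 2*w2)))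
    = w1 * w2 * w3 * ((y - x) * (4*x + 4*y + 2*z))
     - 2 * w3 * (w3 * (r3\<^sup>2 * (w1 * w2)) * (w1 - w2) + w2 * (r2\<^sup>2 * (w1 * w3)) * (2*w1 - w2)
          + w1 * (r1\<^sup>2 * (w2 * w3)) * (w1 - 2*w2))"
    by (simp add: algebra_simps)
  also have "\<dots> = 0"
  proof -
    have w3: "w3 = - w1 - w2" using w by simp
    show ?thesis unfolding r1 r2 r3 x y z unfolding w3 by algebra
  qed
  finally show ?thesis .
qed

lemma has_symmetry_diag_distinct:
  assumes H: "H \<in> H4" and c3: "\<And>i j. c3 H i j = l * d2 H i j + (if i = j then k else 0)"
    and d: "d2 H 1 2 = 0" "d2 H 1 3 = 0" "d2 H 2 3 = 0"
    and neq: "d2 H 1 1 \<noteq> d2 H 2 2" "d2 H 1 1 \<noteq> d2 H 3 3" "d2 H 2 2 \<noteq> d2 H 3 3"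
  shows "has_symmetry H"
proof -
  obtain x y z b c p q s t where co: "harmonic_coords H x y z b c p q s t"
    using harmonic_coords_exist H by blast
  \<comment> \<open>The cross product of (1, 1, 1) with the diagonal of \<open>d2 H\<close>.\<close>
  define w1 w2 w3 where w_def: "w1 = d2 H 3 3 - d2 H 2 2" "w2 = d2 H 1 1 - d2 H 3 3" "w3 = d2 H 2 2 - d2 H 1 1"
  have w: "w1 \<noteq> 0" "w2 \<noteq> 0" "w3 \<noteq> 0" and w3: "w3 = - w1 - w2" using neq by (auto simp: w_def)
  have dw: "d2 H 2 2 = d2 H 3 3 - w1" "d2 H 1 1 = d2 H 3 3 + w2" by (simp_all add: w_def)
  note C = dcontr42_coords[OF co d2_Sym2[OF H], folded c3_def, unfolded c3 d dw]
  txt \<open>Each row \<open>(H\<^sub>i\<^sub>j\<^sub>1\<^sub>1, H\<^sub>i\<^sub>j\<^sub>2\<^sub>2, H\<^sub>i\<^sub>j\<^sub>3\<^sub>3)\<close>, \<open>i \<noteq> j\<close>, has sum zero and is orthogonal to the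
    diagonal of \<open>d2 H\<close>, hence is a multiple of \<open>(w1, w2, w3)\<close>.\<close>
  define r1 r2 r3 where r_def: "r1 = s / w1" "r2 = p / w1" "r3 = b / w1"
  have off: "s = r1 * w1" "t = r1 * w2" "p = r2 * w1" "q = r2 * w2" "b = r3 * w1" "c = r3 * w2"
    using C(1-3) w by (simp_all add: r_def field_simps)
  \<comment> \<open>The matrix \<open>H i i j j\<close> has zero row sums. On sum-zero vectors one
    eigenvector comes from \<open>d2 H\<close>, with eigenvalue \<open>l\<close>, and the other is
    \<open>w\<close>. So the matrix is \<open>T\<close> times the square of \<open>w\<close> plus
    \<open>l\<close> times the projection to sum-zero vectors, whose off-diagonal entries are
    \<open>- l / 3 = - 4 * m\<close>.\<close>
  define m where "m = l / 12"
  define T where "T = (x + 4*m) / (w2 * w3)"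
  have xyz: "x = T * (w2 * w3) - 4*m" "y = T * (w1 * w3) - 4*m" "z = T * (w1 * w2) - 4*m"
  proof -
    have "(y + 4*m) * w2 = (x + 4*m) * w1" "(z + 4*m) * w3 = (x + 4*m) * w1"
      using C(4-6) unfolding m_def w3 by (simp_all add: algebra_simps)
    moreover have T: "x + 4*m = T * (w2 * w3)" using w unfolding T_def by simp
    ultimately have "w2 * (y + 4*m) = w2 * (T * (w1 * w3))" "w3 * (z + 4*m) = w3 * (T * (w1 * w2))"
      by algebra+
    then have "y + 4*m = T * (w1 * w3)" "z + 4*m = T * (w1 * w2)" using w by simp_all
    with T show "x = T * (w2 * w3) - 4*m" "y = T * (w1 * w3) - 4*m" "z = T * (w1 * w2) - 4*m"
      by simp_all
  qed
  have g3: "r3 * (T * w3\<^sup>2 + 5*m) = r1 * r2 * w3"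
  proof -
    have "0 = 4 * w3 * (r1 * r2 * w3 - r3 * (T * w3\<^sup>2 + 5*m))"
      using d2_coords(1)[OF co] d(1) unfolding off xyz w3 by algebra
    then show ?thesis using w by simp
  qed
  have g2: "r2 * (T * w2\<^sup>2 + 5*m) = r1 * r3 * w2"
  proof -
    have "0 = 4 * w2 * (r1 * r3 * w2 - r2 * (T * w2\<^sup>2 + 5*m))"
      using d2_coords(2)[OF co] d(2) unfolding off xyz w3 by algebra
    then show ?thesis using w by simp
  qed
  have g1: "r1 * (T * w1\<^sup>2 + 5*m) = r2 * r3 * w1"
  proof -
    have "0 = 4 * w1 * (r2 * r3 * w1 - r1 * (T * w1\<^sup>2 + 5*m))"
      using d2_coords(3)[OF co] d(3) unfolding off xyz w3 by algebra
    then show ?thesis using w by simp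
  qed
  have "r1 = 0 \<or> r2 = 0 \<or> r3 = 0"
  proof (rule ccontr)
    assume "\<not> ?thesis"
    then have r: "r1 \<noteq> 0" "r2 \<noteq> 0" "r3 \<noteq> 0" by auto
    \<comment> \<open>Each equation is the product of two of \<open>g1\<close>, \<open>g2\<close>,
      \<open>g3\<close>.\<close>
    have "r1 * r2 * (r3\<^sup>2 * (w1 * w2)) = r1 * r2 * ((T * w1\<^sup>2 + 5*m) * (T * w2\<^sup>2 + 5*m))"
      "r1 * r3 * (r2\<^sup>2 * (w1 * w3)) = r1 * r3 * ((T * w1\<^sup>2 + 5*m) * (T * w3\<^sup>2 + 5*m))"
      "r2 * r3 * (r1\<^sup>2 * (w2 * w3)) = r2 * r3 * ((T * w2\<^sup>2 + 5*m) * (T * w3\<^sup>2 + 5*m))"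
      using g1 g2 g3 by algebra+
    then have "r3\<^sup>2 * (w1 * w2) = (T * w1\<^sup>2 + 5*m) * (T * w2\<^sup>2 + 5*m)"
      "r2\<^sup>2 * (w1 * w3) = (T * w1\<^sup>2 + 5*m) * (T * w3\<^sup>2 + 5*m)"
      "r1\<^sup>2 * (w2 * w3) = (T * w2\<^sup>2 + 5*m) * (T * w3\<^sup>2 + 5*m)"
      using r by simp_all
    from diagonal_eigen_identity[OF _ this xyz] w w3
    have "(y - x) * (4*x + 4*y + 2*z)
     - 2 * w3 * (r3\<^sup>2 * (w1 - w2) + r2\<^sup>2 * (2*w1 - w2) + r1\<^sup>2 * (w1 - 2*w2)) = 0"
      by simp
    moreover have "d2 H 1 1 - d2 H 2 2 = (y - x) * (4*x + 4*y + 2*z)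
     - 2 * w3 * (r3\<^sup>2 * (w1 - w2) + r2\<^sup>2 * (2*w1 - w2) + r1\<^sup>2 * (w1 - 2*w2))"
      unfolding d2_coords(4,5)[OF co] unfolding off w3 by algebra
    ultimately show False using neq by simp
  qed
  \<comment> \<open>When one of the three numbers vanishes, its equation among \<open>g1\<close>,
    \<open>g2\<close>, \<open>g3\<close> makes the product of the other two vanish.\<close>
  then consider "r1 = 0" "r2 = 0" | "r1 = 0" "r3 = 0" | "r2 = 0" "r3 = 0"
    using g1 g2 g3 w by auto
  then show ?thesis
    by cases (use has_symmetry_coords[OF co] off in simp_all)
qed

text \<open>Permutes the axes, so that the simple eigenvalue of a diagonal \<open>d2\<close> can be
  moved to the third place.\<close>

definition cyclic_rotation :: "real^3^3" where
  "cyclic_rotation = vector [vector [0, 1, 0], vector [0, 0, 1], vector [1, 0, 0]]"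

lemma cyclic_rotation_SO3: "cyclic_rotation \<in> SO3"
proof -
  have "transpose cyclic_rotation ** cyclic_rotation = mat 1"
    by (simp add: vec_eq_iff matrix_matrix_mult_def transpose_def cyclic_rotation_def mat_def sum_3 forall_3)
  moreover have "det cyclic_rotation = 1"
    by (simp add: det_3 cyclic_rotation_def)
  ultimately show ?thesis by (simp add: SO3_def orthogonal_matrix)
qed

lemma rot1_cyclic:
  "rot1 cyclic_rotation X 1 = X 2" "rot1 cyclic_rotation X 2 = X 3" "rot1 cyclic_rotation X 3 = X 1"
  by (simp_all add: rot1_def cyclic_rotation_def sum_3)

text \<open>The identity tensor is rotation invariant, so the affine relation holds in every frame
  with the same constants.\<close>

lemma c3_affine_act4:
  assumes c3: "\<And>i j. c3 H i j = l * d2 H i j + (if i = j then k else 0)" and g: "g \<in> SO3"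
  shows "c3 (act4 g H) i j = l * d2 (act4 g H) i j + (if i = j then k else 0)"
proof -
  have "act2 g (c3 H) i j = l * act2 g (d2 H) i j + (\<Sum>a\<in>UNIV. g$i$a * g$j$a) * k"
  proof -
    have "g$i$a * g$j$b * c3 H a b
        = l * (g$i$a * g$j$b * d2 H a b) + (if a = b then g$i$a * g$j$a * k else 0)" for a b
      by (simp add: c3 algebra_simps)
    then show ?thesis
      by (simp add: act2_def sum.distrib sum_distrib_left[symmetric] sum_distrib_right[symmetric])
  qed
  then show ?thesis by (simp add: c3_act d2_act SO3_orthogonal[OF g] SO3_row_inner[OF g])
qed

lemma has_symmetry_c3_affine_diag:
  assumes H: "H \<in> H4" and c3: "\<And>i j. c3 H i j = l * d2 H i j + (if i = j then k else 0)"
    and d: "d2 H 1 2 = 0" "d2 H 1 3 = 0" "d2 H 2 3 = 0"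
  shows "has_symmetry H"
proof -
  have sym: "d2 H 2 1 = d2 H 1 2" "d2 H 3 1 = d2 H 1 3" "d2 H 3 2 = d2 H 2 3"
    by (rule Sym2_commute[OF d2_Sym2[OF H]])+
  let ?C = cyclic_rotation
  let ?H1 = "act4 ?C H" and ?H2 = "act4 ?C (act4 ?C H)"
  have o: "orthogonal_matrix ?C" by (rule SO3_orthogonal[OF cyclic_rotation_SO3])
  have H1: "?H1 \<in> H4" and H2: "?H2 \<in> H4" by (simp_all add: act4_H4 o H)
  note c31 = c3_affine_act4[OF c3 cyclic_rotation_SO3]
  note c32 = c3_affine_act4[OF c31 cyclic_rotation_SO3]
  note simps = d2_act[OF o] act2_rot1 rot1_cyclic d sym
  consider "d2 H 1 1 = d2 H 2 2" "d2 H 2 2 = d2 H 3 3"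
    | "d2 H 1 1 = d2 H 2 2" "d2 H 1 1 \<noteq> d2 H 3 3"
    | "d2 H 2 2 = d2 H 3 3" "d2 H 1 1 \<noteq> d2 H 2 2"
    | "d2 H 1 1 = d2 H 3 3" "d2 H 2 2 \<noteq> d2 H 3 3"
    | "d2 H 1 1 \<noteq> d2 H 2 2" "d2 H 1 1 \<noteq> d2 H 3 3" "d2 H 2 2 \<noteq> d2 H 3 3"
    by metis
  then show ?thesis
  proof cases
    case 1
    then have "\<forall>i j. d2 H i j = (if i = j then d2 H 1 1 else 0)"
      by (simp add: forall_3 d sym)
    then show ?thesis using has_symmetry_d2_scalar[OF H] by blast
  next
    case 2
    then show ?thesis by (intro has_symmetry_diag_axial[OF H c3 d])
  next
    case 3
    then have "has_symmetry ?H1"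
      by (intro has_symmetry_diag_axial[OF H1 c31]) (simp_all add: simps)
    then show ?thesis using has_symmetry_act4 cyclic_rotation_SO3 by blast
  next
    case 4
    then have "has_symmetry ?H2"
      by (intro has_symmetry_diag_axial[OF H2 c32]) (simp_all add: simps)
    then show ?thesis using has_symmetry_act4 cyclic_rotation_SO3 by blast
  next
    case 5
    then show ?thesis by (intro has_symmetry_diag_distinct[OF H c3 d])
  qed
qed

lemma has_symmetry_c3_affine:
  assumes H: "H \<in> H4" and c3: "\<And>i j. c3 H i j = l * d2 H i j + (if i = j then k else 0)"
    and d: "d2 H 1 3 = 0" "d2 H 2 3 = 0"
  shows "has_symmetry H"
proof -
  obtain \<theta> where \<theta>: "act2 (rotz \<theta>) (d2 H) 1 2 = 0" using rotz_zero_12[OF d2_Sym2[OF H]] .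
  have o: "orthogonal_matrix (rotz \<theta>)" by (rule SO3_orthogonal[OF rotz_SO3])
  have "has_symmetry (act4 (rotz \<theta>) H)"
    by (rule has_symmetry_c3_affine_diag[OF act4_H4[OF o H] c3_affine_act4[OF c3 rotz_SO3]])
      (simp_all add: d2_act[OF o] \<theta> act2_rotz_13_23 d)
  then show ?thesis using has_symmetry_act4 rotz_SO3 by blast
qed

section \<open>Common axis of the covariants\<close>

lemma has_symmetry_common_axis:
  assumes H: "H \<in> H4"
    and d: "d2 H 1 3 = 0" "d2 H 2 3 = 0" and c: "c3 H 1 3 = 0" "c3 H 2 3 = 0"
    and e: "c4 H 1 3 = 0" "c4 H 2 3 = 0"
  shows "has_symmetry H"
proof -
  \<comment> \<open>With \<open>s = 0\<close> the equations \<open>E\<close> and \<open>E'\<close>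
    share the matrix with rows (\<open>p\<close>, \<open>q\<close>, 0) and (0, \<open>t\<close>,
    \<open>2 * q\<close>), whose rank is easy to read off.\<close>
  obtain \<theta> where \<theta>: "act4 (rotz \<theta>) H 1 1 2 3 = 0" by (rule rotz_zero_1123)
  let ?H = "act4 (rotz \<theta>) H"
  have o: "orthogonal_matrix (rotz \<theta>)" by (rule SO3_orthogonal[OF rotz_SO3])
  have H': "?H \<in> H4" by (rule act4_H4[OF o H])
  have d': "d2 ?H 1 3 = 0" "d2 ?H 2 3 = 0" and c': "c3 ?H 1 3 = 0" "c3 ?H 2 3 = 0"
    and e': "c4 ?H 1 3 = 0" "c4 ?H 2 3 = 0"
    by (simp_all add: d2_act c3_act c4_act o act2_rotz_13_23 d c e)
  obtain x y z b c p q s t where co: "harmonic_coords ?H x y z b c p q s t"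
    using harmonic_coords_exist H' by blast
  have s: "s = 0" using \<theta> co unfolding harmonic_coords_def by simp
  have c3_Sym2: "c3 ?H \<in> Sym2" unfolding c3_def by (rule dcontr42_Sym2[OF H'])
  \<comment> \<open>These triples describe \<open>d2\<close> and \<open>c3\<close> modulo scalars,
    which is all that a traceless tensor sees.\<close>
  define X Y Z X' Y' Z' where XYZ: "X = d2 ?H 1 1 - d2 ?H 3 3" "Y = d2 ?H 2 2 - d2 ?H 3 3" "Z = d2 ?H 1 2"
    "X' = c3 ?H 1 1 - c3 ?H 3 3" "Y' = c3 ?H 2 2 - c3 ?H 3 3" "Z' = c3 ?H 1 2"
  have E: "p * X + q * Y = 0" "t * Y + 2*q * Z = 0"
    using dcontr42_coords(2,3)[OF co d2_Sym2[OF H'], folded c3_def] d' c' s by (simp_all add: XYZ)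
  have E': "p * X' + q * Y' = 0" "t * Y' + 2*q * Z' = 0"
    using dcontr42_coords(2,3)[OF co c3_Sym2, folded c4_def] c' e' s by (simp_all add: XYZ)
  have affine: ?thesis if "X' = l * X" "Y' = l * Y" "Z' = l * Z" for l
  proof -
    have "\<forall>i j. c3 ?H i j = l * d2 ?H i j + (if i = j then c3 ?H 3 3 - l * d2 ?H 3 3 else 0)"
      using that d' c' Sym2_commute[OF c3_Sym2, of 2 1] Sym2_commute[OF c3_Sym2, of 3 1]
        Sym2_commute[OF c3_Sym2, of 3 2] Sym2_commute[OF d2_Sym2[OF H'], of 2 1]
        Sym2_commute[OF d2_Sym2[OF H'], of 3 1] Sym2_commute[OF d2_Sym2[OF H'], of 3 2]
      by (simp add: forall_3 XYZ algebra_simps)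
    then have "has_symmetry ?H" using has_symmetry_c3_affine[OF H' _ d'] by blast
    then show ?thesis using has_symmetry_act4 rotz_SO3 by blast
  qed
  have scalar: ?thesis if "X = 0" "Y = 0" "Z = 0"
  proof -
    have "\<forall>i j. d2 ?H i j = (if i = j then d2 ?H 3 3 else 0)"
      using that d' Sym2_commute[OF d2_Sym2[OF H'], of 2 1]
        Sym2_commute[OF d2_Sym2[OF H'], of 3 1] Sym2_commute[OF d2_Sym2[OF H'], of 3 2]
      by (simp add: forall_3 XYZ)
    then have "has_symmetry ?H" using has_symmetry_d2_scalar[OF H'] by blast
    then show ?thesis using has_symmetry_act4 rotz_SO3 by blast
  qed
  txt \<open>In the first two cases the linear system has a one-dimensional solution space,
    containing both \<open>(X, Y, Z)\<close> and \<open>(X', Y', Z')\<close>.\<close>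
  consider "q \<noteq> 0" | "q = 0" "p \<noteq> 0" "t \<noteq> 0" | "q = 0" "p = 0" "t = 0"
    | "q = 0" "p \<noteq> 0" "t = 0" | "q = 0" "p = 0" "t \<noteq> 0" by blast
  then show ?thesis
  proof cases
    case 1
    then have Y: "Y = - p / q * X" "Y' = - p / q * X'"
      using E(1) E'(1) by (simp_all add: field_simps)
    have Z: "Z = - t / (2*q) * Y" "Z' = - t / (2*q) * Y'"
      using 1 E(2) E'(2) by (simp_all add: field_simps)
    show ?thesis
    proof (cases "X = 0")
      case True
      then show ?thesis using scalar Y Z by simp
    next
      case False
      then show ?thesis using affine[of "X' / X"] Y Z by simp
    qed
  next
    case 2
    then have XY: "X = 0" "Y = 0" "X' = 0" "Y' = 0" using E E' by auto
    show ?thesis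
    proof (cases "Z = 0")
      case True
      then show ?thesis using scalar XY by simp
    next
      case False
      then show ?thesis using affine[of "Z' / Z"] XY by simp
    qed
  next
    case 3
    then have "has_symmetry ?H" using has_symmetry_coords(1)[OF co] s by simp
    then show ?thesis using has_symmetry_act4 rotz_SO3 by blast
  next
    case 4
    \<comment> \<open>In rank one, the off-diagonal entries of \<open>d2\<close> give linear
      relations and \<open>X = 0\<close> a quadratic one; together they force
      \<open>b = c = 0\<close>.\<close>
    have xz: "x = z" and bc: "4*b + 3*c = 0"
      using d2_coords(2,3)[OF co] d' 4 s by simp_all
    have "X = 0" using E(1) 4 by simp
    then have "c * (c + 3*b) = 0"
      using d2_coords(4,6)[OF co] unfolding XYZ 4 s xz by (simp add: algebra_simps power2_eq_square)
    then have "b = 0" "c = 0" using bc by auto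
    then have "has_symmetry ?H" using has_symmetry_coords(2)[OF co] 4 s by simp
    then show ?thesis using has_symmetry_act4 rotz_SO3 by blast
  next
    case 5
    have yz: "y = z" and bc: "4*c + 3*b = 0"
      using d2_coords(2,3)[OF co] d' 5 s by simp_all
    have "Y = 0" using E(2) 5 by simp
    then have "b * (b + 3*c) = 0"
      using d2_coords(5,6)[OF co] unfolding XYZ 5 s yz by (simp add: algebra_simps power2_eq_square)
    then have "b = 0" "c = 0" using bc by auto
    then have "has_symmetry ?H" using has_symmetry_coords(3)[OF co] 5 s by simp
    then show ?thesis using has_symmetry_act4 rotz_SO3 by blast
  qed
qed

section \<open>Axes of rotations and the tensors they fix\<close>

lemma SO3_fixed_axis:
  assumes "g \<in> SO3"
  obtains n where "norm n = 1" "g *v n = n"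
proof -
  have neg: "det (- A) = - det A" for A :: "real^3^3"
    by (simp add: det_3)
  \<comment> \<open>In odd dimension, taking determinants here shows that
    \<open>det (g - mat 1)\<close> equals its own negative.\<close>
  have "transpose g ** (g - mat 1) = - transpose (g - mat 1)"
  proof -
    have "transpose g ** (g - mat 1) = transpose g ** g - transpose g"
      by (simp add: vec_eq_iff matrix_matrix_mult_def mat_def sum_3 forall_3 algebra_simps)
    then show ?thesis
      using SO3_transpose_mult(1)[OF assms] by (simp add: vec_eq_iff transpose_def mat_def forall_3)
  qed
  then have "det (transpose g) * det (g - mat 1) = - det (g - mat 1)"
    by (metis det_mul det_transpose neg)
  then have "det (g - mat 1) = 0"
    using SO3_transpose[OF assms] by (simp add: SO3_def)
  then have "\<not> invertible (g - mat 1)" by (simp add: invertible_det_nz)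
  then obtain v where v: "(g - mat 1) *v v = 0" "v \<noteq> 0"
    by (metis invertible_left_inverse matrix_left_invertible_ker)
  then have "g *v v = v" by (simp add: matrix_vector_mult_diff_rdistrib)
  then have "g *v (v /\<^sub>R norm v) = v /\<^sub>R norm v"
    by (simp add: matrix_vector_mult_scaleR)
  moreover have "norm (v /\<^sub>R norm v) = 1" using v(2) by simp
  ultimately show ?thesis using that by blast
qed

text \<open>The vector (\<open>A 1 3\<close>, \<open>A 2 3\<close>) is fixed by the planar block of
  \<open>g\<close>, a nontrivial plane rotation. The quantity \<open>?r\<close> is the determinant
  of that block minus the identity.\<close>

lemma fixed_tensor_axis:
  assumes g: "g \<in> SO3" "g \<noteq> mat 1" "g *v axis 3 1 = axis 3 1" and A: "act2 g A = A"
  shows "A 1 3 = 0" "A 2 3 = 0"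
proof -
  have col: "g$1$3 = 0" "g$2$3 = 0" "g$3$3 = 1"
    using g(3) by (auto simp: matrix_vector_mult_def vec_eq_iff axis_def forall_3 sum_3)
  have "g$3$1 * g$3$1 + g$3$2 * g$3$2 = 0"
    using SO3_transpose_mult(2)[OF g(1)] col
    by (simp add: vec_eq_iff matrix_matrix_mult_def transpose_def mat_def sum_3 forall_3)
  then have row: "g$3$1 = 0" "g$3$2 = 0" by (auto simp: sum_squares_eq_zero_iff)
  have ortho: "g$1$1 * g$1$1 + g$1$2 * g$1$2 = 1" "g$1$1 * g$2$1 + g$1$2 * g$2$2 = 0"
    using SO3_transpose_mult(2)[OF g(1)] col
    by (simp_all add: vec_eq_iff matrix_matrix_mult_def transpose_def mat_def sum_3 forall_3)
  have det: "g$1$1 * g$2$2 - g$1$2 * g$2$1 = 1"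
    using g(1) col row by (simp add: SO3_def det_3)
  have blk: "g$2$2 = g$1$1" "g$2$1 = - g$1$2"
    using ortho det by algebra+
  let ?r = "(g$1$1 - 1)\<^sup>2 + (g$1$2)\<^sup>2"
  have "?r \<noteq> 0"
  proof
    assume "?r = 0"
    then have "g$1$1 = 1" "g$1$2 = 0" by (simp_all add: sum_power2_eq_zero_iff)
    then have "g = mat 1" using col row blk by (simp add: vec_eq_iff mat_def forall_3)
    then show False using g(2) by simp
  qed
  moreover have "A 1 3 = g$1$1 * A 1 3 + g$1$2 * A 2 3" "A 2 3 = g$2$1 * A 1 3 + g$2$2 * A 2 3"
    using fun_cong[OF fun_cong[OF A, of 1], of 3] fun_cong[OF fun_cong[OF A, of 2], of 3]
    by (simp_all add: act2_def sum_3 col row)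
  then have "?r * A 1 3 = 0" "?r * A 2 3 = 0"
    unfolding blk by algebra+
  ultimately show "A 1 3 = 0" "A 2 3 = 0" by (metis mult_eq_0_iff)+
qed

lemma has_symmetry_of_covariants:
  assumes H: "H \<in> H4" and g: "g \<in> SO3" "g \<noteq> mat 1"
    and fix_d: "act2 g (d2 H) = d2 H" and fix_c: "act2 g (c3 H) = c3 H" and fix_e: "act2 g (c4 H) = c4 H"
  shows "has_symmetry H"
proof -
  obtain n where n: "norm n = 1" "g *v n = n" using SO3_fixed_axis[OF g(1)] .
  obtain h where h: "h \<in> SO3" "h $ 3 = n" using SO3_with_row[OF n(1)] .
  \<comment> \<open>The same rotation in a frame whose third axis is the fixed vector
    \<open>n\<close>.\<close>
  let ?k = "h ** g ** transpose h"
  have hn: "transpose h *v axis 3 1 = n"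
    using h(2) by (simp add: matrix_vector_mult_basis column_transpose row_def)
  have "h *v n = axis 3 1"
    unfolding hn[symmetric]
    by (simp only: matrix_vector_mul_assoc SO3_transpose_mult[OF h(1)] matrix_vector_mul_lid)
  then have k3: "?k *v axis 3 1 = axis 3 1"
    by (simp only: matrix_vector_mul_assoc[symmetric] hn n(2))
  have k: "?k \<in> SO3" by (intro SO3_mult SO3_transpose h g)
  have k1: "?k \<noteq> mat 1"
  proof
    assume "?k = mat 1"
    then have "transpose h ** ?k ** h = mat 1" by (simp add: SO3_transpose_mult[OF h(1)])
    moreover have "transpose h ** ?k ** h = (transpose h ** h) ** g ** (transpose h ** h)"
      by (simp add: matrix_mul_assoc)
    ultimately show False using g(2) by (simp add: SO3_transpose_mult[OF h(1)])
  qed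
  have "act2 ?k (act2 h A) = act2 h A" if "act2 g A = A" for A
  proof -
    have "act2 ?k (act2 h A) = act2 h (act2 g (act2 (transpose h ** h) A))"
      by (simp only: act2_matrix_mult matrix_mul_assoc)
    then show ?thesis by (simp add: SO3_transpose_mult[OF h(1)] act2_mat_1 that)
  qed
  then have *: "act2 h A 1 3 = 0" "act2 h A 2 3 = 0" if "act2 g A = A" for A
    using fixed_tensor_axis[OF k k1 k3, of "act2 h A"] that by blast+
  have o: "orthogonal_matrix h" by (rule SO3_orthogonal[OF h(1)])
  have "has_symmetry (act4 h H)"
    by (rule has_symmetry_common_axis[OF act4_H4[OF o H]])
      (simp_all add: d2_act c3_act c4_act o * fix_d fix_c fix_e)
  then show ?thesis using has_symmetry_act4 h(1) by blast
qed

section \<open>The triple as values of polynomial covariants\<close>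

lemma poly4_sum:
  assumes "finite I" "\<And>i. i \<in> I \<Longrightarrow> (\<lambda>T. p i T) \<in> poly4"
  shows "(\<lambda>T. \<Sum>i\<in>I. p i T) \<in> poly4"
  using assms by (induction I) (auto intro: poly4.intros)

lemma d2_poly: "poly_map42 d2"
  unfolding poly_map42_def d2_def tr13_def dcontr44_def
  by (auto intro!: poly4_sum poly4.intros)

lemma dcontr42_poly:
  assumes "poly_map42 f"
  shows "poly_map42 (\<lambda>T. dcontr42 T (f T))"
  using assms unfolding poly_map42_def dcontr42_def
  by (auto intro!: poly4_sum poly4.intros)

lemma equiv_poly_cov2_dcontr42:
  assumes "equiv_poly_cov2 f"
  shows "equiv_poly_cov2 (\<lambda>T. dcontr42 T (f T))"
  using assms unfolding equiv_poly_cov2_def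
  by (auto simp: dcontr42_poly dcontr42_Sym2 dcontr42_act SO3_orthogonal)

lemma equiv_poly_cov2_d2: "equiv_poly_cov2 d2"
  unfolding equiv_poly_cov2_def by (simp add: d2_poly d2_Sym2 d2_act SO3_orthogonal)

lemma covariants_subset_Cov2: "{d2 H, c3 H, c4 H} \<subseteq> Cov2 H"
proof -
  have "equiv_poly_cov2 c3"
    using equiv_poly_cov2_dcontr42[OF equiv_poly_cov2_d2] by (simp add: c3_def[abs_def])
  moreover from equiv_poly_cov2_dcontr42[OF this] have "equiv_poly_cov2 c4"
    by (simp add: c4_def[abs_def])
  ultimately show ?thesis using equiv_poly_cov2_d2 unfolding Cov2_def by blast
qed

theorem theorem9p16:
  fixes H :: tensor4
  assumes "H \<in> H4"
  shows "(triclinic (symgroup4 H) \<longleftrightarrow> triclinic (symgroup2_set (Cov2 H)))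
       \<and> (triclinic (symgroup2_set (Cov2 H)) \<longleftrightarrow> triclinic (symgroup2_set {d2 H, c3 H, c4 H}))"
proof -
  have "symgroup4 H \<subseteq> symgroup2_set (Cov2 H)"
  proof
    fix g assume "g \<in> symgroup4 H"
    then have g: "g \<in> SO3" "act4 g H = H" by (auto simp: symgroup4_def)
    have "act2 g (f H) = f H" if "equiv_poly_cov2 f" for f
      using that g assms unfolding equiv_poly_cov2_def by metis
    then show "g \<in> symgroup2_set (Cov2 H)"
      using g(1) by (auto simp: symgroup2_set_def Cov2_def)
  qed
  moreover have "symgroup2_set (Cov2 H) \<subseteq> symgroup2_set {d2 H, c3 H, c4 H}"
    using covariants_subset_Cov2[of H] unfolding symgroup2_set_def by blast
  moreover have "mat 1 \<in> symgroup4 H"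
    by (simp add: symgroup4_def SO3_mat_1 act4_mat_1)
  \<comment> \<open>This closes the cycle: the inclusions between the symmetry groups, all
    containing the identity, give the converse implications.\<close>
  moreover have "triclinic (symgroup2_set {d2 H, c3 H, c4 H})" if "triclinic (symgroup4 H)"
  proof -
    have "\<not> has_symmetry H"
      using that unfolding triclinic_def symgroup4_def has_symmetry_def by blast
    then have "symgroup2_set {d2 H, c3 H, c4 H} \<subseteq> {mat 1}"
      using has_symmetry_of_covariants[OF assms] by (auto simp: symgroup2_set_def)
    moreover have "mat 1 \<in> symgroup2_set {d2 H, c3 H, c4 H}"
      by (simp add: symgroup2_set_def SO3_mat_1 act2_mat_1)
    ultimately show ?thesis unfolding triclinic_def by blast
  qed
  ultimately show ?thesis unfolding triclinic_def by blast
qed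

end
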